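(* For every $z\in\mathbb{C}$ with $\Re(z)>-1$, $$\frac{1}{G(1+z)}=\exp\left\{-\frac12\left(\log(2\pi)-1\right)z+(1+\gamma)\frac{z^2}{2}+\int_0^\infty\frac{e^{-zu}-1+zu-\frac{u^2z^2}{2}}{u\left(2\sinh(u/2)\right)^2}\,du\right\},$$ where $G$ is the Barnes G-function and $\gamma$ is Euler's constant.
   Context: The Barnes G-function is defined by $$G(1+z)=(2\pi)^{z/2}\exp\left[-\tfrac12\left((1+\gamma)z^2+z\right)\right]\prod_{n=1}^{\infty}\left(1+\frac{z}{n}\right)^{n}\exp\left[-z+\frac{z^2}{2n}\right],$$ where $\gamma$ is Euler's constant. *)

theory Defs
  imports "HOL-Analysis.Analysis"
begin

text \<open>
  The Weierstrass product is usually stated for \<open>G (1 + z)\<close>, whence the shift \<open>z = w - 1\<close>.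
  The product over \<open>n \<ge> 1\<close> is indexed by \<open>Suc n\<close>; \<^const>\<open>prodinf\<close> also accounts for products
  with vanishing factors, so that \<open>barnes_G\<close> is zero at the non-positive integers.
\<close>

definition barnes_G :: "complex \<Rightarrow> complex" where
  "barnes_G w = (let z = w - 1 in
     complex_of_real (2 * pi) powr (z / 2)
     * exp (- (1 / 2) * ((1 + complex_of_real euler_mascheroni) * z ^ 2 + z))
     * (\<Prod>n. (1 + z / of_nat (Suc n)) ^ Suc n * exp (- z + z ^ 2 / (2 * of_nat (Suc n)))))"

definition barnes_integrand :: "complex \<Rightarrow> real \<Rightarrow> complex" where
  "barnes_integrand z u =
     (exp (- z * of_real u) - 1 + z * of_real u - (of_real u) ^ 2 * z ^ 2 / 2)
     / of_real (u * (2 * sinh (u / 2)) ^ 2)"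

end

theory Submission
  imports Defs "HOL-Real_Asymp.Real_Asymp"
begin

text \<open>
  Expanding \<open>1 / (2 sinh (u/2))\<^sup>2 = \<Sum>n\<ge>1. n e\<^sup>-\<^sup>n\<^sup>u\<close> and integrating termwise reduces the integral to the
  Frullani-type integrals
  \<open>\<integral> e\<^sup>-\<^sup>n\<^sup>u (e\<^sup>-\<^sup>z\<^sup>u - 1 + z u - u\<^sup>2 z\<^sup>2 / 2) / u du = - Ln (1 + z/n) + z/n - z\<^sup>2 / (2 n\<^sup>2)\<close>, which come from
  writing the integrand as an integral over \<open>z\<close> along the segment from \<open>0\<close> and applying Fubini.
  Exponentiating the resulting series gives the reciprocal of the Weierstrass product.
\<close>

section \<open>Exponential majorants on the half line\<close>

lemma set_integrable_exp_minus:
  fixes c :: real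
  assumes "c > 0"
  shows "set_integrable lborel {0<..} (\<lambda>u. exp (- c * u))"
proof -
  have "(\<lambda>u. exp (- c * u)) absolutely_integrable_on {0..}"
    by (intro nonnegative_absolutely_integrable_1 integrable_on_exp_minus_to_infinity assms) simp
  hence "integrable lborel (\<lambda>u. indicat_real {0..} u *\<^sub>R exp (- c * u))"
    unfolding set_integrable_def by (subst (asm) integrable_completion) simp_all
  hence "set_integrable lborel {0..} (\<lambda>u. exp (- c * u))"
    by (simp add: set_integrable_def)
  thus ?thesis
    by (rule set_integrable_subset) auto
qed

lemma set_integrable_exp_bound:
  fixes f :: "real \<Rightarrow> complex"
  assumes "continuous_on {0<..} f" "c > 0"
    and "\<And>u. u > 0 \<Longrightarrow> norm (f u) \<le> K * exp (- c * u)"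
  shows "set_integrable lborel {0<..} f"
proof -
  have "set_integrable lborel {0<..} (\<lambda>u. K * exp (- c * u))"
    using set_integrable_exp_minus[OF assms(2)] by simp
  thus ?thesis
    unfolding set_integrable_def
    by (rule Bochner_Integration.integrable_bound)
       (use assms borel_measurable_continuous_on_indicator[OF _ assms(1)]
        in \<open>force simp: indicator_def intro: order_trans[OF _ abs_ge_self]\<close>)+
qed

lemma le_exp_half:
  fixes c u :: real
  assumes "c > 0"
  shows "u \<le> 2 / c * exp (c / 2 * u)"
  using exp_ge_add_one_self[of "c / 2 * u"] assms by (simp add: field_simps)

text \<open>Half of the decay rate \<open>c\<close> is spent on absorbing the linear factor, via
  \<open>le_exp_half\<close>; the other half survives.\<close>

lemma linear_exp_bound:
  fixes a b c u :: real
  assumes "c > 0" "u > 0" "a \<ge> 0" "b \<ge> 0"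
  shows "(a + b * u) * exp (- c * u) \<le> (a + b * (2 / c)) * exp (- (c / 2) * u)"
proof -
  have "a * exp (- c * u) \<le> a * exp (- (c / 2) * u)"
    using assms by (intro mult_left_mono) auto
  moreover have "u * exp (- c * u) \<le> 2 / c * exp (c / 2 * u) * exp (- c * u)"
    using le_exp_half[OF assms(1)] by (intro mult_right_mono) auto
  hence "u * exp (- c * u) \<le> 2 / c * exp (- (c / 2) * u)"
    by (simp add: mult.assoc flip: exp_add)
  hence "b * (u * exp (- c * u)) \<le> b * (2 / c * exp (- (c / 2) * u))"
    using assms(4) by (intro mult_left_mono) auto
  ultimately show ?thesis by (simp add: algebra_simps)
qed

text \<open>The rate \<open>c\<close> may be any positive lower bound of \<open>Re s\<close>, so
  that one majorant can serve a whole family of exponents \<open>s\<close>, as the Fubini argument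
  requires.\<close>

lemma norm_linear_exp_bound:
  fixes a b s :: complex
  assumes "u > 0" "c > 0" "c \<le> Re s"
  shows "norm ((a + b * of_real u) * exp (- s * of_real u))
    \<le> (norm a + norm b * (2 / c)) * exp (- (c / 2) * u)"
proof -
  have "norm ((a + b * of_real u) * exp (- s * of_real u))
      \<le> (norm a + norm b * u) * exp (- c * u)"
    unfolding norm_mult
    using assms norm_triangle_ineq[of a "b * of_real u"]
    by (intro mult_mono) (auto simp: norm_mult)
  also have "\<dots> \<le> (norm a + norm b * (2 / c)) * exp (- (c / 2) * u)"
    using assms by (intro linear_exp_bound) auto
  finally show ?thesis .
qed

section \<open>Laplace transform of a linear function\<close>

lemma set_integrable_linear_exp:
  fixes a b s :: complex
  assumes "Re s > 0"
  shows "set_integrable lborel {0<..} (\<lambda>u. (a + b * of_real u) * exp (- s * of_real u))"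
  using assms by (intro set_integrable_exp_bound[OF _ _ norm_linear_exp_bound[OF _ assms order_refl]]
        continuous_intros) auto

lemma set_integral_linear_exp:
  fixes a b s :: complex
  assumes s: "Re s > 0"
  shows "(LINT u:{0<..}|lborel. (a + b * of_real u) * exp (- s * of_real u)) = a / s + b / s ^ 2"
proof -
  \<comment> \<open>This antiderivative comes from integration by parts. It vanishes at infinity, so
    the integral is \<open>- F 0\<close>.\<close>
  define F where "F = (\<lambda>u::real. - (a / s + b / s ^ 2 + b / s * of_real u) * exp (- s * of_real u))"
  have s0: "s \<noteq> 0" using s by auto
  have "(LBINT u=ereal 0..\<infinity>. (a + b * of_real u) * exp (- s * of_real u)) = 0 - F 0"
  proof (rule interval_integral_FTC_integrable)
    show "set_integrable lborel (einterval (ereal 0) \<infinity>)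
        (\<lambda>u. (a + b * of_real u) * exp (- s * of_real u))"
      using set_integrable_linear_exp[OF s] by (simp add: zero_ereal_def)
    show "(F has_vector_derivative (a + b * of_real u) * exp (- s * of_real u)) (at u)" for u
    proof -
      have "((\<lambda>w. - (a / s + b / s ^ 2 + b / s * w) * exp (- s * w)) has_field_derivative
          (a + b * of_real u) * exp (- s * of_real u)) (at (of_real u))"
        using s0 by (auto intro!: derivative_eq_intros simp: field_simps power2_eq_square)
      from has_vector_derivative_real_field[OF this] show ?thesis
        by (simp add: F_def)
    qed
    have "isCont F 0"
      unfolding F_def by (intro continuous_intros)
    hence "(F \<longlongrightarrow> F 0) (at_right 0)"
      by (auto simp: isCont_def intro: tendsto_mono[OF at_le])
    thus "((F \<circ> real_of_ereal) \<longlongrightarrow> F 0) (at_right (ereal 0))"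
      by (simp add: ereal_tendsto_simps)
    have "(F \<longlongrightarrow> 0) at_top"
    proof (rule Lim_null_comparison)
      define K where "K = norm (a / s + b / s ^ 2) + norm (b / s) * (2 / Re s)"
      show "\<forall>\<^sub>F u in at_top. norm (F u) \<le> K * exp (- (Re s / 2) * u)"
        using eventually_gt_at_top[of 0]
      proof eventually_elim
        case (elim u)
        from norm_linear_exp_bound[OF elim s order_refl, of "a / s + b / s ^ 2" "b / s"]
        show ?case unfolding F_def K_def by (simp only: norm_mult norm_minus_cancel)
      qed
      have "((\<lambda>u. exp (- (Re s / 2) * u)) \<longlongrightarrow> 0) at_top"
        using s by real_asymp
      thus "((\<lambda>u. K * exp (- (Re s / 2) * u)) \<longlongrightarrow> 0) at_top"
        by (rule tendsto_mult_right_zero)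
    qed
    thus "((F \<circ> real_of_ereal) \<longlongrightarrow> 0) (at_left \<infinity>)"
      by (simp add: ereal_tendsto_simps)
  qed (auto intro!: continuous_intros)
  thus ?thesis
    by (simp add: interval_lebesgue_integral_def F_def zero_ereal_def)
qed

section \<open>Taylor remainder and absolute convergence of the integral\<close>

text \<open>The numerator of \<open>barnes_integrand\<close>: the second-order Taylor remainder of
  \<open>exp\<close> at 0, taken at the point \<open>- z * u\<close>. The Frullani-type integrals
  share it.\<close>

definition exp_remainder :: "complex \<Rightarrow> real \<Rightarrow> complex" where
  "exp_remainder z u = exp (- z * of_real u) - 1 + z * of_real u - (of_real u) ^ 2 * z ^ 2 / 2"

text \<open>Taylor's theorem on the segment from 0 to \<open>w = - z * u\<close>. There
  \<open>norm (exp x)\<close> is at most the larger of 1 and \<open>exp (Re w)\<close>; replacing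
  the maximum by the sum covers both signs of \<open>Re w\<close> at once.\<close>

lemma norm_exp_remainder_le:
  assumes "u > 0"
  shows "norm (exp_remainder z u) \<le> norm z ^ 3 * u ^ 3 * (1 + exp (- Re z * u))"
proof -
  define w where "w = - z * of_real u"
  have "norm (exp w - (\<Sum>i\<le>2. exp 0 * (w - 0) ^ i / fact i))
      \<le> (1 + exp (Re w)) * norm (w - 0) ^ Suc 2 / fact 2"
  proof (rule field_Taylor[where S = "closed_segment 0 w" and f = "\<lambda>_. exp"])
    fix x assume "x \<in> closed_segment 0 w"
    then obtain t where t: "0 \<le> t" "t \<le> 1" "x = of_real t * w"
      by (auto simp: in_segment scaleR_conv_of_real)
    have "t * Re w \<le> max 0 (Re w)"
      using t mult_left_le_one_le[of "Re w" t] mult_nonneg_nonpos[of t "Re w"]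
      by (cases "Re w \<ge> 0") auto
    hence "exp (t * Re w) \<le> exp (max 0 (Re w))" by simp
    also have "\<dots> \<le> 1 + exp (Re w)" by (simp add: max_def)
    finally show "norm (exp x) \<le> 1 + exp (Re w)"
      using t by simp
  qed (auto intro!: derivative_eq_intros)
  also have "\<dots> \<le> (1 + exp (Re w)) * norm w ^ 3"
    by (simp add: numeral_3_eq_3 add_nonneg_nonneg)
  also have "exp w - (\<Sum>i\<le>2. exp 0 * (w - 0) ^ i / fact i) = exp_remainder z u"
    by (simp add: exp_remainder_def w_def numeral_2_eq_2 algebra_simps)
  finally show ?thesis
    using assms by (simp add: w_def norm_mult power_mult_distrib mult_ac)
qed

lemma square_sinh_half:
  "(2 * sinh (u / 2)) ^ 2 = exp u * (1 - exp (- u)) ^ 2" for u :: real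
proof -
  have "2 * sinh (u / 2) = exp (u / 2) * (1 - exp (- u))"
    by (simp add: sinh_def algebra_simps flip: exp_add)
  thus ?thesis
    by (simp add: power_mult_distrib flip: exp_double)
qed

lemma barnes_integrand_eq:
  "barnes_integrand z u = exp_remainder z u / of_real (u * (2 * sinh (u / 2)) ^ 2)"
  by (simp add: barnes_integrand_def exp_remainder_def)

text \<open>Near 0 the cubic order of the remainder cancels the factor \<open>u\<close> and the
  double zero of the squared \<open>sinh\<close>. At infinity that square contributes a factor
  \<open>exp (- u)\<close>, which shifts the rate \<open>Re z\<close> to \<open>1 + Re z\<close>;
  this is where the half plane \<open>Re z > -1\<close> comes from.\<close>

lemma norm_barnes_integrand_le:
  assumes u: "u > 0"
  shows "norm (barnes_integrand z u)
    \<le> norm z ^ 3 * (1 + u) ^ 2 * (exp (- u) + exp (- (1 + Re z) * u))"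
proof -
  \<comment> \<open>Yields the lower bound \<open>u / (1 + u)\<close> for
    \<open>1 - exp (- u)\<close>, of the right order both near 0 and at infinity.\<close>
  have "exp (- u) \<le> 1 / (1 + u)"
    using u exp_ge_add_one_self[of u] by (simp add: exp_minus field_simps)
  hence "u \<le> (1 + u) * (1 - exp (- u))"
    using u by (simp add: field_simps)
  hence "u ^ 2 \<le> (1 + u) ^ 2 * (1 - exp (- u)) ^ 2"
    using u by (metis power_mono less_imp_le power_mult_distrib)
  hence "exp u * u ^ 2 \<le> (1 + u) ^ 2 * (2 * sinh (u / 2)) ^ 2"
    unfolding square_sinh_half by (simp add: mult.left_commute)
  hence *: "u ^ 2 / (2 * sinh (u / 2)) ^ 2 \<le> (1 + u) ^ 2 * exp (- u)"
    using u by (simp add: exp_minus field_simps)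
  have "norm (barnes_integrand z u) = norm (exp_remainder z u) / (u * (2 * sinh (u / 2)) ^ 2)"
    unfolding barnes_integrand_eq norm_divide norm_of_real using u by simp
  also have "\<dots> \<le> norm z ^ 3 * u ^ 3 * (1 + exp (- Re z * u)) / (u * (2 * sinh (u / 2)) ^ 2)"
    using u norm_exp_remainder_le[OF u] by (intro divide_right_mono) auto
  also have "\<dots> = norm z ^ 3 * (1 + exp (- Re z * u)) * (u ^ 2 / (2 * sinh (u / 2)) ^ 2)"
    using u by (simp add: power2_eq_square power3_eq_cube)
  also have "\<dots> \<le> norm z ^ 3 * (1 + exp (- Re z * u)) * ((1 + u) ^ 2 * exp (- u))"
    by (intro mult_left_mono *) (auto intro: add_nonneg_nonneg)
  also have "\<dots> = norm z ^ 3 * (1 + u) ^ 2 * (exp (- u) + exp (- (1 + Re z) * u))"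
    by (simp add: algebra_simps flip: exp_add)
  finally show ?thesis .
qed

lemma set_integrable_barnes_integrand:
  assumes z: "Re z > -1"
  shows "set_integrable lborel {0<..} (barnes_integrand z)"
proof -
  \<comment> \<open>Both exponentials in the bound decay at least like \<open>exp (- c * u)\<close>.
    With \<open>d = c / 4\<close>, squaring \<open>1 + u \<le> exp (d * u) / d\<close> costs only
    half of that rate.\<close>
  define c where "c = min 1 (1 + Re z)"
  define d where "d = c / 4"
  have c: "c > 0" "c \<le> 1" "c \<le> 1 + Re z" using z by (auto simp: c_def)
  hence d: "d > 0" "d \<le> 1" by (auto simp: d_def)
  show ?thesis
  proof (rule set_integrable_exp_bound)
    show "continuous_on {0<..} (barnes_integrand z)"
      unfolding barnes_integrand_def by (intro continuous_intros) auto
    show "c / 2 > 0" using c by simp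
    fix u :: real assume u: "u > 0"
    have "d * (1 + u) \<le> exp (d * u)"
      using d exp_ge_add_one_self[of "d * u"] unfolding distrib_left by linarith
    hence "(1 + u) \<le> exp (d * u) / d" using d by (simp add: field_simps)
    hence "(1 + u) ^ 2 \<le> (exp (d * u) / d) ^ 2" using u by (intro power_mono) auto
    also have "\<dots> = exp (c / 2 * u) / d ^ 2"
      by (simp add: power_divide d_def flip: exp_double)
    finally have *: "(1 + u) ^ 2 \<le> exp (c / 2 * u) / d ^ 2" .
    have "norm (barnes_integrand z u)
        \<le> norm z ^ 3 * (1 + u) ^ 2 * (exp (- u) + exp (- (1 + Re z) * u))"
      by (rule norm_barnes_integrand_le[OF u])
    also have "\<dots> \<le> norm z ^ 3 * (exp (c / 2 * u) / d ^ 2) * (exp (- c * u) + exp (- c * u))"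
      using u c mult_right_mono[OF c(2), of u] mult_right_mono[OF c(3), of u]
      by (intro mult_mono * add_mono) (auto intro: add_nonneg_nonneg simp: algebra_simps)
    also have "\<dots> = 2 * norm z ^ 3 / d ^ 2 * (exp (c / 2 * u) * exp (- c * u))"
      by simp
    also have "exp (c / 2 * u) * exp (- c * u) = exp (- (c / 2) * u)"
      by (simp flip: exp_add)
    finally show "norm (barnes_integrand z u) \<le> 2 * norm z ^ 3 / d ^ 2 * exp (- (c / 2) * u)" .
  qed
qed

text \<open>The differentiated geometric series at \<open>x = exp (- u)\<close>: its value
  \<open>x / (1 - x)^2\<close> is rewritten by \<open>square_sinh_half\<close>.\<close>

lemma exp_series_sinh:
  fixes u :: real
  assumes "u > 0"
  shows "(\<lambda>m. real (Suc m) * exp (- real (Suc m) * u)) sums (1 / (2 * sinh (u / 2)) ^ 2)"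
proof -
  have "(\<lambda>m. exp (- u) * (of_nat (Suc m) * exp (- u) ^ m)) sums
      (exp (- u) * (1 / (1 - exp (- u)) ^ 2))"
    using assms by (intro sums_mult geometric_deriv_sums) simp
  moreover have "exp (- u) * (of_nat (Suc m) * exp (- u) ^ m) = real (Suc m) * exp (- real (Suc m) * u)" for m
    by (simp add: algebra_simps flip: exp_of_nat_mult exp_add)
  moreover have "exp (- u) * (1 / (1 - exp (- u)) ^ 2) = 1 / (2 * sinh (u / 2)) ^ 2"
    unfolding square_sinh_half by (simp add: exp_minus divide_simps)
  ultimately show ?thesis by (simp only:)
qed

section \<open>Frullani-type integrals by Fubini\<close>

text \<open>The kernel is the derivative in \<open>t\<close> of
  \<open>exp (- p * u) * exp_remainder (t * z) u / u\<close>; differentiating removes the division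
  by \<open>u\<close>. Absolute integrability over the product is what Fubini needs.\<close>

lemma Frullani_kernel_integrable:
  fixes z :: complex and p :: real
  assumes p: "p > 0" and z: "Re z > - p"
  shows "integrable (lborel \<Otimes>\<^sub>M lborel)
    (\<lambda>(t, u). indicator {0..1} t *\<^sub>R indicator {0<..} u *\<^sub>R
      ((z - of_real t * z ^ 2 * of_real u) * exp (- of_real p * of_real u)
        - z * exp (- (of_real p + of_real t * z) * of_real u)))"
proof -
  define k where "k = (\<lambda>(t::real, u::real).
      (z - of_real t * z ^ 2 * of_real u) * exp (- of_real p * of_real u)
        - z * exp (- (of_real p + of_real t * z) * of_real u))"
  define c where "c = min p (p + Re z)"
  have c: "c > 0" "c \<le> p" "c \<le> p + Re z" using p z by (auto simp: c_def)
  define K where "K = 2 * norm z + norm z ^ 2 * (2 / c)"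
  have bound: "norm (k (t, u)) \<le> K * exp (- (c / 2) * u)" if t: "0 \<le> t" "t \<le> 1" and u: "u > 0" for t u
  proof -
    \<comment> \<open>The right side is a convex combination of \<open>p\<close> and
      \<open>p + Re z\<close>, each at least \<open>c\<close>; hence the bound is uniform in
      \<open>t\<close>.\<close>
    have "c \<le> p + t * Re z"
    proof -
      have "c = (1 - t) * c + t * c" by (simp add: algebra_simps)
      also have "\<dots> \<le> (1 - t) * p + t * (p + Re z)"
        using t c by (intro add_mono mult_left_mono) auto
      finally show ?thesis by (simp add: algebra_simps)
    qed
    hence c': "c \<le> Re (of_real p + of_real t * z)" by simp
    have 1: "norm ((z - of_real t * z ^ 2 * of_real u) * exp (- of_real p * of_real u))
        \<le> (norm z + norm z ^ 2 * (2 / c)) * exp (- (c / 2) * u)"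
    proof -
      have "norm ((z + (- of_real t * z ^ 2) * of_real u) * exp (- of_real p * of_real u))
        \<le> (norm z + norm (- of_real t * z ^ 2) * (2 / c)) * exp (- (c / 2) * u)"
        using norm_linear_exp_bound[of u c "of_real p" z "- of_real t * z ^ 2"] u c by simp
      also have "\<dots> \<le> (norm z + norm z ^ 2 * (2 / c)) * exp (- (c / 2) * u)"
        using t c by (intro mult_right_mono add_mono)
          (auto simp: norm_mult norm_power intro!: divide_right_mono mult_left_le_one_le)
      finally show ?thesis by simp
    qed
    have 2: "norm (z * exp (- (of_real p + of_real t * z) * of_real u))
        \<le> norm z * exp (- (c / 2) * u)"
      using norm_linear_exp_bound[OF u c(1) c', of z 0] by simp
    have "norm (k (t, u)) \<le> (norm z + norm z ^ 2 * (2 / c)) * exp (- (c / 2) * u)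
        + norm z * exp (- (c / 2) * u)"
      unfolding k_def prod.case by (rule norm_triangle_le_diff[OF add_mono[OF 1 2]])
    thus ?thesis by (simp add: K_def algebra_simps)
  qed
  have "c / 2 > 0" using c by simp
  from set_integrable_exp_minus[OF this]
  have int: "integrable lborel (\<lambda>u. indicator {0<..} u * exp (- (c / 2) * u))"
    by (simp add: set_integrable_def)
  \<comment> \<open>The majorant is a product: the indicator of a bounded interval in
    \<open>t\<close> times an integrable function of \<open>u\<close>.\<close>
  have "integrable (lborel \<Otimes>\<^sub>M lborel)
      (\<lambda>(t, u). indicator {0..1::real} t * (K * (indicator {0<..} u * exp (- (c / 2) * u))))"
  proof (rule lborel_pair.Fubini_integrable)
    show "integrable lborel (\<lambda>t. LINT u|lborel. norm (case (t, u) of (t, u) \<Rightarrow>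
        indicator {0..1::real} t * (K * (indicator {0<..} u * exp (- (c / 2) * u)))))"
      by (simp add: abs_mult)
  qed (use int in \<open>auto simp: case_prod_unfold\<close>)
  hence "integrable (lborel \<Otimes>\<^sub>M lborel)
      (\<lambda>x. indicator {0..1} (fst x) *\<^sub>R indicator {0<..} (snd x) *\<^sub>R k x)"
  proof (rule Bochner_Integration.integrable_bound)
    have "continuous_on UNIV k"
      unfolding k_def case_prod_unfold by (intro continuous_intros)
    hence [measurable]: "k \<in> borel_measurable (lborel \<Otimes>\<^sub>M lborel)"
      by (simp add: lborel_prod borel_measurable_continuous_onI)
    show "(\<lambda>x. indicator {0..1} (fst x) *\<^sub>R indicator {0<..} (snd x) *\<^sub>R k x)
        \<in> borel_measurable (lborel \<Otimes>\<^sub>M lborel)"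
      by measurable
    show "AE x in lborel \<Otimes>\<^sub>M lborel.
        norm (indicator {0..1} (fst x) *\<^sub>R indicator {0<..} (snd x) *\<^sub>R k x)
        \<le> norm (case x of (t, u) \<Rightarrow>
            indicator {0..1} t * (K * (indicator {0<..} u * exp (- (c / 2) * u))))"
      using bound by (intro AE_I2)
        (auto simp: indicator_def case_prod_unfold intro!: order_trans[OF _ abs_ge_self])
  qed
  thus ?thesis
    by (simp add: k_def case_prod_unfold)
qed

text \<open>The kernel is integrated in both orders. Over \<open>t\<close> it gives the integrand of
  the claim; over \<open>u\<close> it gives a rational function of \<open>t\<close>, whose
  antiderivative contains \<open>Ln (1 + t * z / p)\<close>.\<close>

lemma Frullani_integral:
  fixes z :: complex and p :: real
  assumes p: "p > 0" and z: "Re z > - p"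
  shows "set_integrable lborel {0<..} (\<lambda>u. exp (- of_real p * of_real u) * exp_remainder z u / of_real u)"
    and "(LINT u:{0<..}|lborel. exp (- of_real p * of_real u) * exp_remainder z u / of_real u)
      = - Ln (1 + z / of_real p) + z / of_real p - z ^ 2 / (2 * of_real p ^ 2)"
proof -
  define k :: "real \<Rightarrow> real \<Rightarrow> complex" where "k = (\<lambda>t u.
      (z - of_real t * z ^ 2 * of_real u) * exp (- of_real p * of_real u)
        - z * exp (- (of_real p + of_real t * z) * of_real u))"
  define f where "f = (\<lambda>t u. indicat_real {0..1} t *\<^sub>R indicat_real {0<..} u *\<^sub>R k t u)"
  have int: "integrable (lborel \<Otimes>\<^sub>M lborel) (case_prod f)"
    using Frullani_kernel_integrable[OF assms] by (simp add: f_def k_def)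
  \<comment> \<open>Gives convergence of the inner \<open>u\<close>-integral, and later keeps
    \<open>1 + t * z / p\<close> off the branch cut of \<open>Ln\<close>.\<close>
  have pz: "Re (of_real p + of_real t * z) > 0" if "0 \<le> t" "t \<le> 1" for t
  proof (cases "Re z \<ge> 0")
    case True
    thus ?thesis using p that by (simp add: add_pos_nonneg)
  next
    case False
    hence "Re z \<le> t * Re z" using that by (simp add: mult_le_cancel_right1)
    thus ?thesis using z by simp
  qed
  have pz_nonzero: "of_real p + of_real t * z \<noteq> 0" if "0 \<le> t" "t \<le> 1" for t
    using pz[OF that] by force

  have inner_t: "(LINT t|lborel. f t u) =
      indicator {0<..} u *\<^sub>R (exp (- of_real p * of_real u) * exp_remainder z u / of_real u)" for u
  proof (cases "u > 0")
    case False
    thus ?thesis by (simp add: f_def)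
  next
    case u: True
    \<comment> \<open>An antiderivative of the kernel in \<open>t\<close>, extended to complex
      \<open>w\<close> so that complex differentiation applies. The term
      \<open>- exp (- p * u) / u\<close> of the remainder is constant in \<open>w\<close> and
      reappears as part of \<open>- G 0\<close>.\<close>
    define G where "G = (\<lambda>w. exp (- (of_real p + w * z) * of_real u) / of_real u
        + (w * z - w ^ 2 * of_real u * z ^ 2 / 2) * exp (- of_real p * of_real u))"
    have "(LINT t|lborel. f t u) = (LINT t|lborel. indicator {0..1} t *\<^sub>R k t u)"
      using u by (simp add: f_def)
    also have "\<dots> = G (of_real 1) - G (of_real 0)"
    proof (rule integral_FTC_Icc)
      fix t :: real
      have "(G has_field_derivative k t u) (at (of_real t))"
        unfolding G_def k_def using u
        by (auto intro!: derivative_eq_intros simp: field_simps power2_eq_square)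
      from has_vector_derivative_real_field[OF this]
      show "((\<lambda>t. G (of_real t)) has_vector_derivative k t u) (at t within {0..1})"
        by (simp add: has_vector_derivative_at_within)
    next
      show "continuous_on {0..1} (\<lambda>t. k t u)"
        unfolding k_def by (intro continuous_intros)
    qed simp
    also have "\<dots> = exp (- of_real p * of_real u) * exp_remainder z u / of_real u"
      using u by (simp add: G_def exp_remainder_def exp_add exp_diff exp_minus field_simps power2_eq_square)
    finally show ?thesis using u by simp
  qed

  \<comment> \<open>Integrability comes from Fubini, with no separate estimate near 0.\<close>
  show "set_integrable lborel {0<..} (\<lambda>u. exp (- of_real p * of_real u) * exp_remainder z u / of_real u)"
    using lborel_pair.integrable_snd[OF int] by (simp add: inner_t set_integrable_def)

  have inner_u: "(LINT u|lborel. f t u) = indicator {0..1} t *\<^sub>R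
      (z / of_real p - of_real t * z ^ 2 / of_real p ^ 2 - z / (of_real p + of_real t * z))" for t
  proof (cases "0 \<le> t \<and> t \<le> 1")
    case False
    thus ?thesis by (simp add: f_def)
  next
    case t: True
    \<comment> \<open>Both terms are put in the shape of \<open>set_integral_linear_exp\<close>, the
      second with slope 0.\<close>
    have "(LINT u|lborel. f t u) = (LINT u:{0<..}|lborel.
        (z + (- of_real t * z ^ 2) * of_real u) * exp (- of_real p * of_real u)
        - (z + 0 * of_real u) * exp (- (of_real p + of_real t * z) * of_real u))"
      using t by (simp add: f_def k_def set_lebesgue_integral_def)
    also have "\<dots> = (LINT u:{0<..}|lborel. (z + (- of_real t * z ^ 2) * of_real u) * exp (- of_real p * of_real u))
        - (LINT u:{0<..}|lborel. (z + 0 * of_real u) * exp (- (of_real p + of_real t * z) * of_real u))"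
      using p pz t by (intro set_integral_diff set_integrable_linear_exp) auto
    also have "\<dots> = (z / of_real p + (- of_real t * z ^ 2) / of_real p ^ 2)
        - (z / (of_real p + of_real t * z) + 0 / (of_real p + of_real t * z) ^ 2)"
      using p pz t by (intro arg_cong2[of _ _ _ _ "(-)"] set_integral_linear_exp) auto
    finally show ?thesis using t by simp
  qed

  have "(LINT u:{0<..}|lborel. exp (- of_real p * of_real u) * exp_remainder z u / of_real u)
      = (LINT u|lborel. LINT t|lborel. f t u)"
    by (simp add: inner_t set_lebesgue_integral_def)
  also have "\<dots> = (LINT t|lborel. LINT u|lborel. f t u)"
    by (rule lborel_pair.Fubini_integral[OF int])
  also have "\<dots> = (LINT t|lborel. indicator {0..1} t *\<^sub>R
      (z / of_real p - of_real t * z ^ 2 / of_real p ^ 2 - z / (of_real p + of_real t * z)))"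
    by (simp add: inner_u)
  also have "\<dots> = (of_real 1 * z / of_real p - of_real 1 ^ 2 * z ^ 2 / (2 * of_real p ^ 2)
        - Ln (1 + of_real 1 * z / of_real p))
      - (of_real 0 * z / of_real p - of_real 0 ^ 2 * z ^ 2 / (2 * of_real p ^ 2)
        - Ln (1 + of_real 0 * z / of_real p))"
  proof (rule integral_FTC_Icc)
    fix t :: real assume t: "0 \<le> t" "t \<le> 1"
    note nz = pz_nonzero[OF t]
    have "Re (1 + of_real t * z / of_real p) > 0"
      using pz[OF t] p by (simp add: field_simps)
    hence "1 + of_real t * z / of_real p \<notin> \<real>\<^sub>\<le>\<^sub>0"
      by (auto simp: complex_nonpos_Reals_iff)
    hence L: "((\<lambda>w. Ln (1 + w * z / of_real p)) has_field_derivative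
        z / (of_real p + of_real t * z)) (at (of_real t))"
      using p nz by (auto intro!: derivative_eq_intros simp: field_simps)
    have "((\<lambda>w. w * z / of_real p - w ^ 2 * z ^ 2 / (2 * of_real p ^ 2)) has_field_derivative
        z / of_real p - of_real t * z ^ 2 / of_real p ^ 2) (at (of_real t))"
      using p by (auto intro!: derivative_eq_intros simp: field_simps power2_eq_square)
    from DERIV_diff[OF this L] have "((\<lambda>w. w * z / of_real p - w ^ 2 * z ^ 2 / (2 * of_real p ^ 2)
          - Ln (1 + w * z / of_real p)) has_field_derivative
        (z / of_real p - of_real t * z ^ 2 / of_real p ^ 2 - z / (of_real p + of_real t * z)))
        (at (of_real t))"
      .
    from has_vector_derivative_real_field[OF this]
    show "((\<lambda>t. of_real t * z / of_real p - of_real t ^ 2 * z ^ 2 / (2 * of_real p ^ 2)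
          - Ln (1 + of_real t * z / of_real p)) has_vector_derivative
        (z / of_real p - of_real t * z ^ 2 / of_real p ^ 2 - z / (of_real p + of_real t * z)))
        (at t within {0..1})"
      by (simp add: has_vector_derivative_at_within)
  next
    show "continuous_on {0..1} (\<lambda>t. z / of_real p - of_real t * z ^ 2 / of_real p ^ 2
        - z / (of_real p + of_real t * z))"
      using p pz_nonzero by (intro continuous_intros) auto
  qed simp
  finally show "(LINT u:{0<..}|lborel. exp (- of_real p * of_real u) * exp_remainder z u / of_real u)
      = - Ln (1 + z / of_real p) + z / of_real p - z ^ 2 / (2 * of_real p ^ 2)"
    by simp
qed

section \<open>Termwise integration and the Weierstrass product\<close>

text \<open>Dominated convergence with the integrand itself as majorant: the weights
  \<open>n * exp (- n * u)\<close> are nonnegative, so their partial sums stay below the full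
  sum.\<close>

lemma barnes_integral_sums:
  assumes z: "Re z > -1"
  shows "(\<lambda>m. - of_nat (Suc m) * Ln (1 + z / of_nat (Suc m)) + z - z ^ 2 / (2 * of_nat (Suc m)))
    sums (LINT u:{0<..}|lborel. barnes_integrand z u)"
proof -
  define g where "g = (\<lambda>m u. indicat_real {0<..} u *\<^sub>R
      (of_nat (Suc m) * (exp (- of_real (real (Suc m)) * of_real u) * exp_remainder z u / of_real u)))"
  define h where "h = (\<lambda>u. indicat_real {0<..} u *\<^sub>R barnes_integrand z u)"
  have h: "integrable lborel h"
    using set_integrable_barnes_integrand[OF z] by (simp add: h_def set_integrable_def)
  have zm: "Re z > - real (Suc m)" for m using z by simp
  have int_g: "integrable lborel (g m)" for m
    using Frullani_integral(1)[OF _ zm, of m] unfolding g_def set_integrable_def[symmetric]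
    by (intro set_integrable_mult_right) auto
  \<comment> \<open>\<open>g m\<close> and \<open>h\<close> differ only in a real scalar factor, so
    convergence and domination reduce to the real series \<open>exp_series_sinh\<close>.\<close>
  have g_eq: "g m u = of_real (real (Suc m) * exp (- real (Suc m) * u)) * 
      (indicat_real {0<..} u *\<^sub>R (exp_remainder z u / of_real u))" for m u
    by (simp add: g_def flip: exp_of_real)
  have h_eq: "h u = of_real (1 / (2 * sinh (u / 2)) ^ 2) *
      (indicat_real {0<..} u *\<^sub>R (exp_remainder z u / of_real u))" for u
    by (simp add: h_def barnes_integrand_eq)
  have "(\<lambda>n. LINT u|lborel. (\<Sum>m<n. g m u)) \<longlonglongrightarrow> integral\<^sup>L lborel h"
  proof (rule integral_dominated_convergence)
    show "integrable lborel (\<lambda>u. norm (h u))" using h by (rule integrable_norm)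
    show "h \<in> borel_measurable lborel" using h by (rule borel_measurable_integrable)
    show "(\<lambda>u. \<Sum>m<n. g m u) \<in> borel_measurable lborel" for n
      using int_g by (intro borel_measurable_sum borel_measurable_integrable)
    show "AE u in lborel. (\<lambda>n. \<Sum>m<n. g m u) \<longlonglongrightarrow> h u"
    proof (rule AE_I2)
      fix u :: real
      show "(\<lambda>n. \<Sum>m<n. g m u) \<longlonglongrightarrow> h u"
      proof (cases "u > 0")
        case True
        show ?thesis
          unfolding g_eq h_eq sums_def[symmetric]
          by (intro sums_mult2 sums_of_real exp_series_sinh True)
      qed (simp add: g_def h_def)
    qed
    show "AE u in lborel. norm (\<Sum>m<n. g m u) \<le> norm (h u)" for n
    proof (rule AE_I2)
      fix u :: real
      show "norm (\<Sum>m<n. g m u) \<le> norm (h u)"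
      proof (cases "u > 0")
        case True
        have "(\<Sum>m<n. real (Suc m) * exp (- real (Suc m) * u)) \<le> 1 / (2 * sinh (u / 2)) ^ 2"
          using sum_le_suminf[of "\<lambda>m. real (Suc m) * exp (- real (Suc m) * u)" "{..<n}"]
            exp_series_sinh[OF True] by (simp add: sums_iff)
        moreover have "0 \<le> (\<Sum>m<n. real (Suc m) * exp (- real (Suc m) * u))"
          by (intro sum_nonneg) auto
        ultimately show ?thesis
          unfolding g_eq h_eq sum_distrib_right[symmetric] of_real_sum[symmetric] norm_mult norm_of_real
          by (intro mult_right_mono) auto
      qed (simp add: g_def h_def)
    qed
  qed
  moreover have "(LINT u|lborel. (\<Sum>m<n. g m u)) = (\<Sum>m<n. LINT u|lborel. g m u)" for n
    using int_g by (intro Bochner_Integration.integral_sum)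
  ultimately have "(\<lambda>m. LINT u|lborel. g m u) sums integral\<^sup>L lborel h"
    by (simp add: sums_def)
  moreover have "(LINT u|lborel. g m u) =
      - of_nat (Suc m) * Ln (1 + z / of_nat (Suc m)) + z - z ^ 2 / (2 * of_nat (Suc m))" for m
  proof -
    have "(LINT u|lborel. g m u) = of_nat (Suc m) *
        (LINT u:{0<..}|lborel. exp (- of_real (real (Suc m)) * of_real u) * exp_remainder z u / of_real u)"
      unfolding g_def set_lebesgue_integral_def[symmetric] by (rule set_integral_mult_right)
    also have "\<dots> = of_nat (Suc m) *
        (- Ln (1 + z / of_nat (Suc m)) + z / of_nat (Suc m) - z ^ 2 / (2 * of_nat (Suc m) ^ 2))"
      by (subst Frullani_integral(2)[OF _ zm]) (simp_all del: of_nat_Suc)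
    also have "\<dots> = - of_nat (Suc m) * Ln (1 + z / of_nat (Suc m)) + z - z ^ 2 / (2 * of_nat (Suc m))"
      by (simp add: field_simps power2_eq_square del: of_nat_Suc)
    finally show ?thesis .
  qed
  ultimately show ?thesis
    by (simp add: h_def set_lebesgue_integral_def)
qed

text \<open>Each factor is the exponential of the negated summand in
  \<open>barnes_integral_sums\<close>, so the convergent series turns into the product. The half
  plane excludes the negative integers, where a factor would vanish.\<close>

lemma barnes_product_eq:
  assumes z: "Re z > -1"
  shows "(\<Prod>n. (1 + z / of_nat (Suc n)) ^ Suc n * exp (- z + z ^ 2 / (2 * of_nat (Suc n))))
    = exp (- (LINT u:{0<..}|lborel. barnes_integrand z u))"
proof -
  have nz: "1 + z / of_nat (Suc n) \<noteq> 0" for n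
  proof
    assume "1 + z / of_nat (Suc n) = 0"
    hence "z = - of_nat (Suc n)" by (simp add: field_simps add_eq_0_iff del: of_nat_Suc)
    with z show False by simp
  qed
  define a where "a = (\<lambda>n. - of_nat (Suc n) * Ln (1 + z / of_nat (Suc n)) + z - z ^ 2 / (2 * of_nat (Suc n)))"
  have a: "(\<lambda>n. - a n) sums (- (LINT u:{0<..}|lborel. barnes_integrand z u))"
    unfolding a_def by (intro sums_minus barnes_integral_sums z)
  have "(1 + z / of_nat (Suc n)) ^ Suc n * exp (- z + z ^ 2 / (2 * of_nat (Suc n))) = exp (- a n)" for n
  proof -
    have "exp (- a n) = exp (of_nat (Suc n) * Ln (1 + z / of_nat (Suc n)))
        * exp (- z + z ^ 2 / (2 * of_nat (Suc n)))"
      unfolding exp_add[symmetric] by (rule arg_cong[where f = exp]) (simp add: a_def algebra_simps)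
    \<comment> \<open>The multiplier is a natural number, so no branch of the logarithm
      interferes.\<close>
    also have "exp (of_nat (Suc n) * Ln (1 + z / of_nat (Suc n))) = (1 + z / of_nat (Suc n)) ^ Suc n"
      unfolding exp_of_nat_mult exp_Ln[OF nz] ..
    finally show ?thesis by simp
  qed
  thus ?thesis
    using prodinf_exp[of "\<lambda>n. - a n"] a by (simp add: sums_iff)
qed

text \<open>Integrability is stated separately because a Lebesgue integral that does not exist has
  the default value 0; the identity alone would not express convergence.\<close>

theorem proposition2p3:
  fixes z :: complex
  assumes "Re z > -1"
  shows "set_integrable lborel {0<..} (barnes_integrand z) \<and>
    1 / barnes_G (1 + z) =
      exp (- (1 / 2) * (complex_of_real (ln (2 * pi)) - 1) * z
           + (1 + complex_of_real euler_mascheroni) * z ^ 2 / 2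
           + (LINT u:{0<..}|lborel. barnes_integrand z u))"
proof
  show "set_integrable lborel {0<..} (barnes_integrand z)"
    by (rule set_integrable_barnes_integrand[OF assms])
  define J where "J = (LINT u:{0<..}|lborel. barnes_integrand z u)"
  \<comment> \<open>The base is a positive real, so its principal logarithm is the real one.\<close>
  have "complex_of_real (2 * pi) powr (z / 2) = exp (z / 2 * of_real (ln (2 * pi)))"
    unfolding powr_def by (subst Ln_of_real) auto
  hence "barnes_G (1 + z) = exp (z / 2 * of_real (ln (2 * pi)))
      * exp (- (1 / 2) * ((1 + of_real euler_mascheroni) * z ^ 2 + z)) * exp (- J)"
    using barnes_product_eq[OF assms] by (simp add: barnes_G_def Let_def J_def)
  hence "1 / barnes_G (1 + z) = exp (- (z / 2 * of_real (ln (2 * pi))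
      + - (1 / 2) * ((1 + of_real euler_mascheroni) * z ^ 2 + z) + - J))"
    by (simp only: exp_minus exp_add inverse_eq_divide)
  also have "- (z / 2 * of_real (ln (2 * pi))
      + - (1 / 2) * ((1 + of_real euler_mascheroni) * z ^ 2 + z) + - J) =
      - (1 / 2) * (complex_of_real (ln (2 * pi)) - 1) * z
      + (1 + of_real euler_mascheroni) * z ^ 2 / 2 + J"
    by (simp add: field_simps)
  finally show "1 / barnes_G (1 + z) =
      exp (- (1 / 2) * (complex_of_real (ln (2 * pi)) - 1) * z
           + (1 + complex_of_real euler_mascheroni) * z ^ 2 / 2
           + (LINT u:{0<..}|lborel. barnes_integrand z u))"
    by (simp only: J_def)
qed

end
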